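(* Let $X$ be a PCS and $t\in P(!X\multimap\mathbf 1)$. For every $p\in[0,1)$ and all $x,y\in P(X)$ with $\|x\|_X\le p$ and $\|y\|_X\le p$, $$|\hat t(x)-\hat t(y)|\le\frac{d_X(x,y)}{1-p}.$$
   Context: A PCS $X$ is a countable set $|X|$ with $P(X)\subseteq\mathbb R_{\ge0}^{|X|}$ such that $P(X)^{\perp\perp}=P(X)$, where $Q^\perp=\{u'\mid\forall u\in Q\ \sum_au_au'_a\le1\}$, and $0<\sup_{x\in P(X)}x_a<\infty$ for each $a$. $\mathbf 1$ has web $\{*\}$ and $P(\mathbf 1)=[0,1]$. $!X$ has web the finite multisets over $|X|$ and $P(!X)=\{x^!\mid x\in P(X)\}^{\perp\perp}$, $x^!_\mu=\prod_ax_a^{\mu(a)}$; $!X\multimap\mathbf 1$ has elements the families $t=(t_\mu)$ with $\sum_\mu t_\mu w_\mu\le1$ for all $w\in P(!X)$, and $\hat t(x)=\sum_\mu t_\mu\prod_ax_a^{\mu(a)}$. Norm: $\|x\|_X=\inf\{r>0\mid x\in rP(X)\}$ for $x$ with $\epsilon x\in P(X)$ for some $\epsilon>0$. Distance on $P(X)$: $d_X(x,y)=\|x-(x\wedge y)\|_X+\|y-(x\wedge y)\|_X$, where $(x\wedge y)_a=\min(x_a,y_a)$. *)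

theory Defs
  imports
    "HOL-Library.Countable_Set"
    "HOL-Library.Multiset"
    "HOL-Library.Extended_Nonnegative_Real"
    "HOL-Analysis.Infinite_Sum"
begin

text \<open>
  A family in \<open>\<real>\<^sub>\<ge>\<^sub>0\<close> indexed by a set \<open>W\<close> is encoded as a function on the whole type that
  vanishes outside \<open>W\<close>.
\<close>

definition nonneg_families :: "'a set \<Rightarrow> ('a \<Rightarrow> real) set" where
  "nonneg_families W = {u. (\<forall>a\<in>W. 0 \<le> u a) \<and> (\<forall>a. a \<notin> W \<longrightarrow> u a = 0)}"

text \<open>
  The pairing of two nonnegative families is an unconditional sum with value in \<open>[0, \<infinity>]\<close>,
  hence taken in \<^typ>\<open>ennreal\<close>: being at most 1 includes convergence.
\<close>

definition orth :: "'a set \<Rightarrow> ('a \<Rightarrow> real) set \<Rightarrow> ('a \<Rightarrow> real) set" where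
  "orth W Q = {u' \<in> nonneg_families W. \<forall>u\<in>Q. (\<Sum>\<^sub>\<infinity>a\<in>W. ennreal (u a * u' a)) \<le> 1}"

record 'a pcs =
  web :: "'a set"
  pts :: "('a \<Rightarrow> real) set"

definition is_pcs :: "'a pcs \<Rightarrow> bool" where
  "is_pcs X \<longleftrightarrow>
     countable (web X) \<and>
     pts X \<subseteq> nonneg_families (web X) \<and>
     orth (web X) (orth (web X) (pts X)) = pts X \<and>
     (\<forall>a\<in>web X. 0 < (SUP x\<in>pts X. ennreal (x a)) \<and> (SUP x\<in>pts X. ennreal (x a)) < \<infinity>)"

text \<open>
  If \<open>x\<close> vanishes outside \<open>W\<close>, then \<open>promote x\<close> vanishes outside the multisets over \<open>W\<close>, so it is
  again a family in the sense above.
\<close>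

definition promote :: "('a \<Rightarrow> real) \<Rightarrow> 'a multiset \<Rightarrow> real" where
  "promote x \<mu> = (\<Prod>a\<in>set_mset \<mu>. x a ^ count \<mu> a)"

definition bang :: "'a pcs \<Rightarrow> 'a multiset pcs" where
  "bang X =
     (let W = {\<mu>. set_mset \<mu> \<subseteq> web X}
      in \<lparr>web = W, pts = orth W (orth W (promote ` pts X))\<rparr>)"

text \<open>
  The space \<open>X \<multimap> \<^bold>1\<close>, with its web \<open>|X| \<times> {*}\<close> identified with \<open>|X|\<close>. Since \<open>P(\<^bold>1) = [0, 1]\<close>, its
  elements are the families \<open>t\<close> with \<open>\<Sum>\<^sub>a t\<^sub>a w\<^sub>a \<le> 1\<close> for all \<open>w \<in> P(X)\<close>.
\<close>

definition lin_to_one :: "'a pcs \<Rightarrow> 'a pcs" where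
  "lin_to_one X =
     \<lparr>web = web X,
      pts = {t \<in> nonneg_families (web X).
               \<forall>w\<in>pts X. (\<Sum>\<^sub>\<infinity>a\<in>web X. ennreal (t a * w a)) \<le> 1}\<rparr>"

text \<open>
  For \<open>t \<in> P(!X \<multimap> \<^bold>1)\<close> and \<open>x \<in> P(X)\<close> the real sum below converges, because \<open>promote x \<in> P(!X)\<close>.
\<close>

definition fun_of :: "'a pcs \<Rightarrow> ('a multiset \<Rightarrow> real) \<Rightarrow> ('a \<Rightarrow> real) \<Rightarrow> real" where
  "fun_of X t x = (\<Sum>\<^sub>\<infinity>\<mu>\<in>web (bang X). t \<mu> * (\<Prod>a\<in>set_mset \<mu>. x a ^ count \<mu> a))"

text \<open>
  Meaningful only if \<open>\<epsilon> x \<in> P(X)\<close> for some \<open>\<epsilon> > 0\<close>; otherwise the infimum is over the empty set.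
\<close>

definition pcs_norm :: "'a pcs \<Rightarrow> ('a \<Rightarrow> real) \<Rightarrow> real" where
  "pcs_norm X x = Inf {r. 0 < r \<and> x \<in> (\<lambda>u a. r * u a) ` pts X}"

text \<open>
  On \<open>P(X)\<close> both norms are meaningful, since \<open>P(X)\<close> is closed downwards for the pointwise order.
\<close>

definition pcs_dist :: "'a pcs \<Rightarrow> ('a \<Rightarrow> real) \<Rightarrow> ('a \<Rightarrow> real) \<Rightarrow> real" where
  "pcs_dist X x y =
     (let m = (\<lambda>a. min (x a) (y a))
      in pcs_norm X (\<lambda>a. x a - m a) + pcs_norm X (\<lambda>a. y a - m a))"

end

theory Submission imports Defs begin

text \<open>
  Write \<open>m = x \<and> y\<close>. By monotonicity it suffices to bound \<open>f x - f m\<close>, where \<open>f = fun_of X t\<close> is a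
  power series with nonnegative coefficients, hence convex along the ray from \<open>m\<close> in a nonnegative
  direction. If \<open>x \<in> q P(X)\<close> and \<open>x - m \<in> r P(X)\<close>, then for \<open>\<lambda> = r / (1 - q)\<close> the point \<open>z\<close> with
  \<open>x = (1 - \<lambda>) m + \<lambda> z\<close> still lies in \<open>P(X)\<close>, so \<open>f z \<le> 1\<close> and \<open>f x - f m \<le> \<lambda>\<close>
  (which is trivial when \<open>\<lambda> \<ge> 1\<close>).
\<close>

section \<open>Polars via finite partial sums\<close>

lemma infsum_ennreal_le_iff:
  fixes f :: "'a \<Rightarrow> real"
  assumes f: "\<And>a. a \<in> W \<Longrightarrow> 0 \<le> f a" and c: "0 \<le> c"
  shows "(\<Sum>\<^sub>\<infinity>a\<in>W. ennreal (f a)) \<le> ennreal c \<longleftrightarrow> (\<forall>F. finite F \<and> F \<subseteq> W \<longrightarrow> sum f F \<le> c)"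
proof -
  have "(\<Sum>a\<in>F. ennreal (f a)) = ennreal (sum f F)" if "finite F \<and> F \<subseteq> W" for F
    using that f by (intro sum_ennreal) auto
  then have "(\<Sum>\<^sub>\<infinity>a\<in>W. ennreal (f a)) = (SUP F\<in>{F. finite F \<and> F \<subseteq> W}. ennreal (sum f F))"
    by (subst nonneg_infsum_complete) (auto intro!: SUP_cong)
  then show ?thesis
    using c by (auto simp: SUP_le_iff)
qed

lemma nonneg_familiesD: "u \<in> nonneg_families W \<Longrightarrow> 0 \<le> u a"
  by (cases "a \<in> W") (auto simp: nonneg_families_def)

text \<open>A nonnegative sum is the supremum of its finite partial sums, so the polar is cut out by
  real inequalities over finite sets, and no convergence question arises when it is
  manipulated.\<close>

lemma mem_orth_iff:
  assumes "Q \<subseteq> nonneg_families W"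
  shows "u' \<in> orth W Q \<longleftrightarrow>
    u' \<in> nonneg_families W \<and> (\<forall>u\<in>Q. \<forall>F. finite F \<and> F \<subseteq> W \<longrightarrow> (\<Sum>a\<in>F. u a * u' a) \<le> 1)"
proof -
  have "(\<Sum>\<^sub>\<infinity>a\<in>W. ennreal (u a * u' a)) \<le> 1 \<longleftrightarrow>
      (\<forall>F. finite F \<and> F \<subseteq> W \<longrightarrow> (\<Sum>a\<in>F. u a * u' a) \<le> 1)"
    if "u' \<in> nonneg_families W" "u \<in> Q" for u
  proof -
    have "0 \<le> u a * u' a" for a
      using that assms by (intro mult_nonneg_nonneg nonneg_familiesD[of _ W]) auto
    from infsum_ennreal_le_iff[of W, OF this zero_le_one] show ?thesis
      by simp
  qed
  then show ?thesis
    unfolding orth_def by blast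
qed

lemma orth_nonneg: "orth W Q \<subseteq> nonneg_families W"
  by (auto simp: orth_def)

lemma subset_orth_orth:
  assumes "Q \<subseteq> nonneg_families W"
  shows "Q \<subseteq> orth W (orth W Q)"
proof
  fix u assume "u \<in> Q"
  then show "u \<in> orth W (orth W Q)"
    using assms
    by (auto simp: mem_orth_iff[OF orth_nonneg] mem_orth_iff[OF assms] mult.commute[of _ "u _"])
qed

text \<open>Every constraint defining a polar is a linear inequality with nonnegative coefficients
  and right-hand side 1. Such constraints survive both subconvex combination and passage to a
  smaller family.\<close>

lemma orth_subconvex:
  assumes Q: "Q \<subseteq> nonneg_families W"
    and v: "v \<in> orth W Q" and w: "w \<in> orth W Q"
    and \<alpha>: "0 \<le> \<alpha>" and \<beta>: "0 \<le> \<beta>" and le: "\<alpha> + \<beta> \<le> 1"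
    and z: "z \<in> nonneg_families W" and zle: "\<And>a. z a \<le> \<alpha> * v a + \<beta> * w a"
  shows "z \<in> orth W Q"
  unfolding mem_orth_iff[OF Q]
proof (intro conjI ballI allI impI z)
  fix u F assume u: "u \<in> Q" and F: "finite F \<and> F \<subseteq> W"
  have "(\<Sum>a\<in>F. u a * z a) \<le> (\<Sum>a\<in>F. u a * (\<alpha> * v a + \<beta> * w a))"
    using u Q by (intro sum_mono mult_left_mono zle) (auto simp: subset_iff intro: nonneg_familiesD)
  also have "\<dots> = \<alpha> * (\<Sum>a\<in>F. u a * v a) + \<beta> * (\<Sum>a\<in>F. u a * w a)"
    by (simp add: sum_distrib_left sum.distrib algebra_simps)
  also have "\<dots> \<le> \<alpha> * 1 + \<beta> * 1"
    using v w u F \<alpha> \<beta> by (intro add_mono mult_left_mono) (auto simp: mem_orth_iff[OF Q])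
  finally show "(\<Sum>a\<in>F. u a * z a) \<le> 1"
    using le by simp
qed

section \<open>Order and convexity properties of P(X)\<close>

lemma pcs_nonneg: "is_pcs X \<Longrightarrow> u \<in> pts X \<Longrightarrow> 0 \<le> u a"
  by (auto simp: is_pcs_def intro: nonneg_familiesD)

text \<open>P(X) equals its bipolar, hence is itself a polar.\<close>

lemma pcs_subconvex:
  assumes X: "is_pcs X" and v: "v \<in> pts X" and w: "w \<in> pts X"
    and "0 \<le> \<alpha>" "0 \<le> \<beta>" "\<alpha> + \<beta> \<le> 1"
    and z: "\<And>a. 0 \<le> z a" and zle: "\<And>a. z a \<le> \<alpha> * v a + \<beta> * w a"
  shows "z \<in> pts X"
proof -
  have oo: "pts X = orth (web X) (orth (web X) (pts X))"
    and "v \<in> nonneg_families (web X)" "w \<in> nonneg_families (web X)"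
    using X v w by (auto simp: is_pcs_def)
  \<comment> \<open>Off the web, \<open>z a\<close> is squeezed between 0 and a combination of
    zeros.\<close>
  then have "z a = 0" if "a \<notin> web X" for a
    using z[of a] zle[of a] that by (auto simp: nonneg_families_def)
  then have "z \<in> nonneg_families (web X)"
    using z by (auto simp: nonneg_families_def)
  then show ?thesis
    using assms oo orth_subconvex[OF orth_nonneg, of v "web X" "pts X" w \<alpha> \<beta> z] by simp
qed

lemma pcs_downward_closed:
  assumes "is_pcs X" "v \<in> pts X" "\<And>a. 0 \<le> z a" "\<And>a. z a \<le> v a"
  shows "z \<in> pts X"
  using assms pcs_subconvex[of X v v 1 0 z] by simp

section \<open>Monomials\<close>

lemma promote_eq_prod_mset: "promote x \<mu> = prod_mset (image_mset x \<mu>)"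
  by (simp add: promote_def image_prod_mset_multiplicity)

lemma promote_nonneg: "(\<And>a. 0 \<le> x a) \<Longrightarrow> 0 \<le> promote x \<mu>"
  by (auto simp: promote_def intro!: prod_nonneg)

lemma promote_mono:
  assumes "\<And>a. 0 \<le> x a" "\<And>a. x a \<le> y a"
  shows "promote x \<mu> \<le> promote y \<mu>"
  using assms by (auto simp: promote_def intro!: prod_mono power_mono)

text \<open>Along an increasing segment each factor is nonnegative, affine and nondecreasing, and
  products of nonnegative nondecreasing convex functions are convex. The order
  \<open>m a \<le> z a\<close> matters: a monomial such as the product of two coordinates is not
  convex in all directions.\<close>

lemma promote_convex:
  assumes m: "\<And>a. 0 \<le> m a" and z: "\<And>a. m a \<le> z a" and l: "0 \<le> l" "l \<le> 1"
  shows "promote (\<lambda>a. (1 - l) * m a + l * z a) \<mu> \<le> (1 - l) * promote m \<mu> + l * promote z \<mu>"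
proof (induction \<mu>)
  case empty
  show ?case by (simp add: promote_def)
next
  case (add a \<mu>)
  let ?A = "promote m \<mu>" and ?B = "promote z \<mu>" and ?c = "(1 - l) * m a + l * z a"
  have step: "promote x (add_mset a \<mu>) = x a * promote x \<mu>" for x :: "'a \<Rightarrow> real"
    by (simp add: promote_eq_prod_mset)
  have "0 \<le> ?c"
    using m[of a] z[of a] l by (intro add_nonneg_nonneg mult_nonneg_nonneg) auto
  then have "?c * promote (\<lambda>a. (1 - l) * m a + l * z a) \<mu> \<le> ?c * ((1 - l) * ?A + l * ?B)"
    by (intro mult_left_mono add.IH)
  \<comment> \<open>The correction term is a product of two increments of the same sign:
    \<open>z a - m a\<close>, and \<open>?B - ?A\<close> by monotonicity.\<close>
  also have "\<dots> = (1 - l) * (m a * ?A) + l * (z a * ?B) - l * (1 - l) * ((z a - m a) * (?B - ?A))"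
    by (simp add: algebra_simps)
  also have "\<dots> \<le> (1 - l) * (m a * ?A) + l * (z a * ?B)"
    using z[of a] l promote_mono[OF m z, where \<mu> = \<mu>] by simp
  finally show ?case
    by (simp add: step)
qed

section \<open>The power series as a function on P(X)\<close>

lemma fun_of_eq: "fun_of X t x = (\<Sum>\<^sub>\<infinity>\<mu>\<in>web (bang X). t \<mu> * promote x \<mu>)"
  by (simp add: fun_of_def promote_def)

lemma lin_to_one_nonneg: "t \<in> pts (lin_to_one Y) \<Longrightarrow> 0 \<le> t \<mu>"
  by (auto simp: lin_to_one_def intro: nonneg_familiesD)

lemma promote_in_bang:
  assumes X: "is_pcs X" and x: "x \<in> pts X"
  shows "promote x \<in> pts (bang X)"
proof -
  let ?W = "{\<mu>. set_mset \<mu> \<subseteq> web X}"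
  have "promote u \<in> nonneg_families ?W" if u: "u \<in> pts X" for u
  proof -
    have "u \<in> nonneg_families (web X)"
      using X u by (auto simp: is_pcs_def)
    \<comment> \<open>Some element of \<open>\<mu>\<close> lies off the web, and it contributes a
      zero factor with positive exponent.\<close>
    then have "promote u \<mu> = 0" if "\<mu> \<notin> ?W" for \<mu>
      using that by (force simp: promote_def nonneg_families_def)
    then show ?thesis
      using pcs_nonneg[OF X u] by (auto simp: nonneg_families_def intro: promote_nonneg)
  qed
  then have "promote ` pts X \<subseteq> nonneg_families ?W"
    by auto
  from subset_orth_orth[OF this] show ?thesis
    using x by (auto simp: bang_def Let_def)
qed

text \<open>Pairing \<open>t\<close> with the point \<open>promote x\<close> of P(!X) gives at most
  1 in \<open>ennreal\<close>. This bounds all finite partial sums of the nonnegative real series,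
  which yields convergence and the bound at once.\<close>

lemma fun_of_converges:
  assumes X: "is_pcs X" and t: "t \<in> pts (lin_to_one (bang X))" and x: "x \<in> pts X"
  shows "(\<lambda>\<mu>. t \<mu> * promote x \<mu>) summable_on web (bang X)" and "fun_of X t x \<le> 1"
proof -
  let ?f = "\<lambda>\<mu>. t \<mu> * promote x \<mu>"
  have nn: "0 \<le> ?f \<mu>" for \<mu>
    using lin_to_one_nonneg[OF t] promote_nonneg[of x \<mu>] pcs_nonneg[OF X x] by simp
  have "(\<Sum>\<^sub>\<infinity>\<mu>\<in>web (bang X). ennreal (?f \<mu>)) \<le> ennreal 1"
    using t promote_in_bang[OF X x] by (auto simp: lin_to_one_def)
  then have fin: "sum ?f F \<le> 1" if "finite F" "F \<subseteq> web (bang X)" for F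
    using that nn by (subst (asm) infsum_ennreal_le_iff) auto
  show summable: "?f summable_on web (bang X)"
    using nn fin by (intro nonneg_bdd_above_summable_on bdd_aboveI2[where M = 1]) auto
  show "fun_of X t x \<le> 1"
    unfolding fun_of_eq by (intro infsum_le_finite_sums summable fin)
qed

lemma fun_of_nonneg:
  assumes "is_pcs X" "t \<in> pts (lin_to_one (bang X))" "x \<in> pts X"
  shows "0 \<le> fun_of X t x"
  unfolding fun_of_eq
  by (intro infsum_nonneg mult_nonneg_nonneg promote_nonneg lin_to_one_nonneg[OF assms(2)]
      pcs_nonneg[OF assms(1,3)])

lemma fun_of_mono:
  assumes X: "is_pcs X" and t: "t \<in> pts (lin_to_one (bang X))"
    and m: "m \<in> pts X" and x: "x \<in> pts X" and le: "\<And>a. m a \<le> x a"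
  shows "fun_of X t m \<le> fun_of X t x"
  unfolding fun_of_eq
  by (intro infsum_mono fun_of_converges[OF X t] m x mult_left_mono promote_mono
      lin_to_one_nonneg[OF t] pcs_nonneg[OF X m] le)

text \<open>Convexity of the monomials, summed with the nonnegative weights \<open>t \<mu>\<close>;
  all the series converge because the three points lie in P(X).\<close>

lemma fun_of_convex:
  assumes X: "is_pcs X" and t: "t \<in> pts (lin_to_one (bang X))"
    and m: "m \<in> pts X" and z: "z \<in> pts X" and x: "x \<in> pts X" and le: "\<And>a. m a \<le> z a"
    and l: "0 \<le> l" "l \<le> 1" and xeq: "x = (\<lambda>a. (1 - l) * m a + l * z a)"
  shows "fun_of X t x \<le> (1 - l) * fun_of X t m + l * fun_of X t z"
proof -
  note s = fun_of_converges(1)[OF X t]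
  have "fun_of X t x \<le> (\<Sum>\<^sub>\<infinity>\<mu>\<in>web (bang X). (1 - l) * (t \<mu> * promote m \<mu>) + l * (t \<mu> * promote z \<mu>))"
    unfolding fun_of_eq
  proof (intro infsum_mono s x summable_on_add summable_on_cmult_right m z)
    fix \<mu>
    have "t \<mu> * promote x \<mu> \<le> t \<mu> * ((1 - l) * promote m \<mu> + l * promote z \<mu>)"
      unfolding xeq
      by (intro mult_left_mono promote_convex pcs_nonneg[OF X m] le l lin_to_one_nonneg[OF t])
    then show "t \<mu> * promote x \<mu> \<le> (1 - l) * (t \<mu> * promote m \<mu>) + l * (t \<mu> * promote z \<mu>)"
      by (simp add: algebra_simps)
  qed
  also have "\<dots> = (1 - l) * fun_of X t m + l * fun_of X t z"
    unfolding fun_of_eq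
    by (simp add: infsum_add infsum_cmult_right' summable_on_cmult_right s m z)
  finally show ?thesis .
qed

section \<open>The Lipschitz estimate\<close>

text \<open>The estimate for arbitrary scalars \<open>q\<close> and \<open>r\<close> competing in
  the two norms, since the infima need not be attained. Multiplying out \<open>1 - q\<close> keeps
  it meaningful for \<open>q \<ge> 1\<close>.\<close>

lemma fun_of_diff_le_scaled:
  assumes X: "is_pcs X" and t: "t \<in> pts (lin_to_one (bang X))"
    and x: "x \<in> pts X" and m: "\<And>a. 0 \<le> m a" and le: "\<And>a. m a \<le> x a"
    and v: "v \<in> pts X" and xv: "\<And>a. x a = q * v a" and q: "0 < q"
    and w: "w \<in> pts X" and xmw: "\<And>a. x a - m a = r * w a" and r: "0 < r"
  shows "(fun_of X t x - fun_of X t m) * (1 - q) \<le> r"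
proof -
  have mX: "m \<in> pts X"
    using pcs_downward_closed[OF X x m le] .
  have D: "fun_of X t x - fun_of X t m \<le> 1"
    using fun_of_converges(2)[OF X t x] fun_of_nonneg[OF X t mX] by linarith
  have D0: "0 \<le> fun_of X t x - fun_of X t m"
    using fun_of_mono[OF X t mX x le] by simp
  \<comment> \<open>Only the last case needs convexity. In the first the left side is at most 0; in
    the second the difference of two values in [0, 1] is at most 1.\<close>
  consider "1 \<le> q" | "q < 1" "1 - q \<le> r" | "q < 1" "r < 1 - q"
    by linarith
  then show ?thesis
  proof cases
    case 1
    then have "(fun_of X t x - fun_of X t m) * (1 - q) \<le> 0"
      using D0 by (simp add: mult_nonneg_nonpos)
    then show ?thesis using r by linarith
  next
    case 2
    then have "(fun_of X t x - fun_of X t m) * (1 - q) \<le> 1 * (1 - q)"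
      by (intro mult_right_mono D) auto
    also have "\<dots> \<le> r" using 2 by simp
    finally show ?thesis .
  next
    case 3
    define l where "l = r / (1 - q)"
    \<comment> \<open>Since \<open>m \<le> x = q v\<close>, there is room to add
      \<open>(1 - q) w\<close>: \<open>z\<close> is dominated by a convex combination of
      \<open>v\<close> and \<open>w\<close>. The choice of \<open>l\<close> makes
      \<open>l (z - m) = r w = x - m\<close>.\<close>
    define z where "z = (\<lambda>a. m a + (1 - q) * w a)"
    have l: "0 \<le> l" "l \<le> 1" and lr: "l * (1 - q) = r"
      using 3 r by (auto simp: l_def)
    have w0: "0 \<le> (1 - q) * w a" for a
      using 3 pcs_nonneg[OF X w] by simp
    have zX: "z \<in> pts X"
    proof (rule pcs_subconvex[OF X v w, of q "1 - q"])
      show "0 \<le> z a" for a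
        using m[of a] w0[of a] by (simp add: z_def)
      show "z a \<le> q * v a + (1 - q) * w a" for a
        using le[of a] xv[of a] by (simp add: z_def)
    qed (use 3 q in auto)
    have "x = (\<lambda>a. (1 - l) * m a + l * z a)"
    proof
      fix a
      have "(1 - l) * m a + l * z a = m a + (l * (1 - q)) * w a"
        by (simp add: z_def algebra_simps)
      then show "x a = (1 - l) * m a + l * z a"
        using xmw[of a] by (simp add: lr)
    qed
    then have "fun_of X t x \<le> (1 - l) * fun_of X t m + l * fun_of X t z"
      using w0 by (intro fun_of_convex[OF X t mX zX x _ l]) (auto simp: z_def)
    also have "\<dots> \<le> fun_of X t m + l * 1"
    proof -
      have "l * fun_of X t z \<le> l * 1"
        by (intro mult_left_mono fun_of_converges[OF X t zX] l)
      moreover have "(1 - l) * fun_of X t m \<le> 1 * fun_of X t m"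
        using l by (intro mult_right_mono fun_of_nonneg[OF X t mX]) auto
      ultimately show ?thesis by linarith
    qed
    finally have "fun_of X t x - fun_of X t m \<le> l"
      by simp
    then have "(fun_of X t x - fun_of X t m) * (1 - q) \<le> l * (1 - q)"
      using 3 by (intro mult_right_mono) auto
    then show ?thesis by (simp add: lr)
  qed
qed

lemma pcs_norm_greatest:
  assumes x: "x \<in> pts X" and c: "\<And>r v. 0 < r \<Longrightarrow> v \<in> pts X \<Longrightarrow> x = (\<lambda>a. r * v a) \<Longrightarrow> c \<le> r"
  shows "c \<le> pcs_norm X x"
  unfolding pcs_norm_def
proof (rule cInf_greatest)
  \<comment> \<open>A point of P(X) is 1 times itself, so the infimum is over a nonempty
    set.\<close>
  have "1 \<in> {r. 0 < r \<and> x \<in> (\<lambda>u a. r * u a) ` pts X}"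
    using x by (auto simp: image_iff)
  then show "{r. 0 < r \<and> x \<in> (\<lambda>u a. r * u a) ` pts X} \<noteq> {}"
    by blast
qed (use c in auto)

text \<open>The two infima are taken one after the other: first over \<open>r\<close> with
  \<open>q\<close> fixed, which produces the norm of \<open>x - m\<close>, then over
  \<open>q\<close>, which produces the norm of \<open>x\<close>.\<close>

lemma fun_of_diff_le:
  assumes X: "is_pcs X" and t: "t \<in> pts (lin_to_one (bang X))"
    and x: "x \<in> pts X" and m: "\<And>a. 0 \<le> m a" and le: "\<And>a. m a \<le> x a"
    and p: "pcs_norm X x \<le> p" "p < 1"
  shows "fun_of X t x - fun_of X t m \<le> pcs_norm X (\<lambda>a. x a - m a) / (1 - p)"
proof -
  define D where "D = fun_of X t x - fun_of X t m"
  define N where "N = pcs_norm X (\<lambda>a. x a - m a)"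
  have u: "(\<lambda>a. x a - m a) \<in> pts X"
    using m le by (intro pcs_downward_closed[OF X x]) auto
  have D0: "0 \<le> D"
    unfolding D_def using fun_of_mono[OF X t pcs_downward_closed[OF X x m le] x le] by simp
  have N: "D * (1 - q) \<le> N" if q: "0 < q" and v: "v \<in> pts X" and xv: "x = (\<lambda>a. q * v a)" for q v
    unfolding N_def
  proof (rule pcs_norm_greatest[OF u])
    fix r w assume "0 < r" "w \<in> pts X" "(\<lambda>a. x a - m a) = (\<lambda>a. r * w a)"
    then show "D * (1 - q) \<le> r"
      unfolding D_def using q
      by (intro fun_of_diff_le_scaled[OF X t x m le v]) (auto simp: xv fun_eq_iff)
  qed
  have "D * (1 - p) \<le> N"
  \<comment> \<open>To become a lower bound for \<open>q\<close>, the inequality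
    \<open>D * (1 - q) \<le> N\<close> is solved as \<open>(D - N) / D \<le> q\<close>, which
    requires \<open>D > 0\<close>. For \<open>D = 0\<close> only \<open>0 \<le> N\<close>
    remains.\<close>
  proof (cases "D = 0")
    case True
    have "0 \<le> N"
      unfolding N_def by (rule pcs_norm_greatest[OF u]) simp
    then show ?thesis by (simp add: True)
  next
    case False
    then have D: "0 < D" using D0 by simp
    have "(D - N) / D \<le> pcs_norm X x"
    proof (rule pcs_norm_greatest[OF x])
      fix q v assume "0 < q" "v \<in> pts X" "x = (\<lambda>a. q * v a)"
      from N[OF this] show "(D - N) / D \<le> q"
        using D by (simp add: field_simps)
    qed
    then have "(D - N) / D \<le> p" using p by linarith
    then show ?thesis using D by (simp add: field_simps)
  qed
  then show ?thesis
    using p by (simp add: D_def N_def field_simps)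
qed

theorem theorem3p5:
  fixes X :: "'a pcs" and t :: "'a multiset \<Rightarrow> real" and p :: real and x y :: "'a \<Rightarrow> real"
  assumes "is_pcs X"
    and "t \<in> pts (lin_to_one (bang X))"
    and "0 \<le> p" and "p < 1"
    and "x \<in> pts X" and "y \<in> pts X"
    and "pcs_norm X x \<le> p" and "pcs_norm X y \<le> p"
  shows "\<bar>fun_of X t x - fun_of X t y\<bar> \<le> pcs_dist X x y / (1 - p)"
proof -
  note X = assms(1) and t = assms(2) and x = assms(5) and y = assms(6)
  define m where "m = (\<lambda>a. min (x a) (y a))"
  define f where "f = fun_of X t"
  have m: "0 \<le> m a" "m a \<le> x a" "m a \<le> y a" for a
    using pcs_nonneg[OF X x] pcs_nonneg[OF X y] by (auto simp: m_def)
  have mX: "m \<in> pts X"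
    using pcs_downward_closed[OF X x m(1,2)] .
  \<comment> \<open>With \<open>f m\<close> below both values, the absolute difference is at most
    \<open>(f x - f m) + (f y - f m)\<close>, which matches the two summands of the
    distance.\<close>
  have "f m \<le> f x" "f m \<le> f y"
    unfolding f_def using fun_of_mono[OF X t mX] x y m by auto
  moreover have "f x - f m \<le> pcs_norm X (\<lambda>a. x a - m a) / (1 - p)"
    and "f y - f m \<le> pcs_norm X (\<lambda>a. y a - m a) / (1 - p)"
    unfolding f_def using assms m by (auto intro!: fun_of_diff_le)
  moreover have "pcs_dist X x y / (1 - p) =
      pcs_norm X (\<lambda>a. x a - m a) / (1 - p) + pcs_norm X (\<lambda>a. y a - m a) / (1 - p)"
    by (simp add: pcs_dist_def m_def add_divide_distrib)
  ultimately show ?thesis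
    unfolding f_def by linarith
qed

end
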